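(* Let $\phi\in\mathcal{A}$, and let $f_j=h_j+\overline{g_j}\in\mathcal{S}_{\mathcal H}^0$ $(j=1,2)$ with $f_j\in\mathcal{W}_{\mathcal H}^{1}(\phi)$, i.e. $h_j+g_j=\phi$ for $j=1,2$. If $\phi$ is convex in the direction of the imaginary axis, then $f_3=tf_1+(1-t)f_2$ $(0\le t\le 1)$ is univalent and convex in the direction of the imaginary axis.
   Context: $\mathbb{D}=\{z\in\mathbb{C}:|z|<1\}$. $\mathcal H$ is the class of complex-valued harmonic functions $f$ in $\mathbb D$ with $f(0)=f_{\bar z}(0)=f_z(0)-1=0$; each is written $f=h+\overline g$ with $h(z)=z+\sum_{n\ge2}a_nz^n$ and $g(z)=\sum_{n\ge2}b_nz^n$ analytic in $\mathbb D$. $\mathcal S_{\mathcal H}^0$ is the subclass of $\mathcal H$ of univalent, sense-preserving functions (a function in $\mathcal H$ is locally univalent and sense-preserving if and only if $|g'|<|h'|$ in $\mathbb D$). $\mathcal A$ is the subclass of $\mathcal H$ of normalized analytic functions. For $\phi\in\mathcal A$ and $|\lambda|=1$, $\mathcal W_{\mathcal H}^\lambda(\phi)=\{h+\overline g\in\mathcal H: h+\lambda g=\phi\}$. A domain is convex in the direction of the imaginary axis if its intersection with each vertical line is connected or empty; a function in $\mathcal H$ is convex in the direction of the imaginary axis if it maps $\mathbb D$ onto such a domain.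
   Formalization: The formal theorem additionally assumes that φ is univalent in the unit disc; if "convex in the direction of the imaginary axis" restricts only the image φ(D), the claim fails for some non-univalent φ, already with f_1 = f_2. *)

theory Defs
  imports "HOL-Complex_Analysis.Complex_Analysis"
begin

abbreviation unit_disc :: "complex set" where
  "unit_disc \<equiv> ball 0 1"

definition dx :: "(complex \<Rightarrow> complex) \<Rightarrow> complex \<Rightarrow> complex" where
  "dx f z = vector_derivative (\<lambda>t. f (z + of_real t)) (at (0::real))"

definition dy :: "(complex \<Rightarrow> complex) \<Rightarrow> complex \<Rightarrow> complex" where
  "dy f z = vector_derivative (\<lambda>t. f (z + \<i> * of_real t)) (at (0::real))"

text \<open>Wirtinger derivatives.\<close>

definition dz :: "(complex \<Rightarrow> complex) \<Rightarrow> complex \<Rightarrow> complex" where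
  "dz f z = (dx f z - \<i> * dy f z) / 2"

definition dzbar :: "(complex \<Rightarrow> complex) \<Rightarrow> complex \<Rightarrow> complex" where
  "dzbar f z = (dx f z + \<i> * dy f z) / 2"

text \<open>
  Complex-valued harmonic functions: twice continuously differentiable over the reals, with
  vanishing Laplacian (\<^const>\<open>differentiable\<close> is real Frechet differentiability).
\<close>

definition complex_harmonic_on :: "(complex \<Rightarrow> complex) \<Rightarrow> complex set \<Rightarrow> bool" where
  "complex_harmonic_on f S \<longleftrightarrow>
     (\<forall>z\<in>S. f differentiable (at z) \<and> dx f differentiable (at z) \<and> dy f differentiable (at z)) \<and>
     continuous_on S (dx (dx f)) \<and> continuous_on S (dx (dy f)) \<and>
     continuous_on S (dy (dx f)) \<and> continuous_on S (dy (dy f)) \<and>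
     (\<forall>z\<in>S. dx (dx f) z + dy (dy f) z = 0)"

text \<open>Functions are total; in all the classes below only the values on the unit disc matter.\<close>

definition class_H :: "(complex \<Rightarrow> complex) set" where
  "class_H = {f. complex_harmonic_on f unit_disc \<and> f 0 = 0 \<and> dzbar f 0 = 0 \<and> dz f 0 - 1 = 0}"

text \<open>
  The canonical representation \<open>f = h + cnj g\<close> of a function in \<open>class_H\<close>; the conditions at
  \<open>0\<close> say that \<open>h\<close> and \<open>g\<close> have power series \<open>z + a\<^sub>2 z\<^sup>2 + \<dots>\<close> and \<open>b\<^sub>2 z\<^sup>2 + \<dots>\<close>.
\<close>

definition harmonic_rep ::
    "(complex \<Rightarrow> complex) \<Rightarrow> (complex \<Rightarrow> complex) \<Rightarrow> (complex \<Rightarrow> complex) \<Rightarrow> bool" where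
  "harmonic_rep f h g \<longleftrightarrow>
     h holomorphic_on unit_disc \<and> g holomorphic_on unit_disc \<and>
     h 0 = 0 \<and> deriv h 0 = 1 \<and> g 0 = 0 \<and> deriv g 0 = 0 \<and>
     (\<forall>z\<in>unit_disc. f z = h z + cnj (g z))"

text \<open>
  The Jacobian of \<open>f = h + cnj g\<close> is \<open>|f\<^sub>z|\<^sup>2 - |f\<^sub>z\<^sub>b\<^sub>a\<^sub>r|\<^sup>2 = |h'|\<^sup>2 - |g'|\<^sup>2\<close>, so this is the condition
  \<open>|g'| < |h'|\<close>.
\<close>

definition sense_preserving_on :: "(complex \<Rightarrow> complex) \<Rightarrow> complex set \<Rightarrow> bool" where
  "sense_preserving_on f S \<longleftrightarrow> (\<forall>z\<in>S. cmod (dzbar f z) < cmod (dz f z))"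

definition class_SH0 :: "(complex \<Rightarrow> complex) set" where
  "class_SH0 = {f \<in> class_H. inj_on f unit_disc \<and> sense_preserving_on f unit_disc}"

definition class_A :: "(complex \<Rightarrow> complex) set" where
  "class_A = {f \<in> class_H. f holomorphic_on unit_disc}"

text \<open>Used for \<open>|\<lambda>| = 1\<close>.\<close>

definition class_W :: "complex \<Rightarrow> (complex \<Rightarrow> complex) \<Rightarrow> (complex \<Rightarrow> complex) set" where
  "class_W lam \<phi> = {f \<in> class_H. \<exists>h g. harmonic_rep f h g \<and>
     (\<forall>z\<in>unit_disc. h z + lam * g z = \<phi> z)}"

definition domain_convex_imag :: "complex set \<Rightarrow> bool" where
  "domain_convex_imag S \<longleftrightarrow> open S \<and> connected S \<and> S \<noteq> {} \<and>
     (\<forall>c::real. connected (S \<inter> {z. Re z = c}))"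

text \<open>
  This concerns the image only and does not include univalence. A shear of a function that is
  merely locally univalent with such an image need not have such an image, so univalence has to be
  required separately.
\<close>

definition convex_imag :: "(complex \<Rightarrow> complex) \<Rightarrow> bool" where
  "convex_imag f \<longleftrightarrow> domain_convex_imag (f ` unit_disc)"

end

theory Submission
  imports Defs
begin

text \<open>
  If \<open>h + g = \<phi>\<close>, then \<open>h + cnj g = \<phi> - 2 \<i> Im g\<close>, and \<open>|g'| < |h'|\<close> says \<open>Re (g' / \<phi>') < 1/2\<close>.
  The latter condition is convex in \<open>g\<close>, so it passes to \<open>t f\<^sub>1 + (1 - t) f\<^sub>2\<close>. In the coordinate
  \<open>w = \<phi> z\<close> the combination is the vertical shear \<open>w \<mapsto> w - 2 \<i> Im (G w)\<close> with
  \<open>Re G' < 1/2\<close>; it maps every vertical section of the image of \<open>\<phi>\<close> into the same vertical line,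
  strictly increasingly.
\<close>

text \<open>The imaginary parts of a connected vertical section form a connected subset of the
  reals, that is, an interval. Derivatives along a vertical segment of \<open>S\<close> can then be
  taken at every point between its ends.\<close>

lemma vertical_section_segment:
  fixes S :: "complex set"
  assumes "connected (S \<inter> {z. Re z = c})"
    and "Complex c a \<in> S" "Complex c b \<in> S" "a \<le> y" "y \<le> b"
  shows "Complex c y \<in> S"
proof -
  let ?T = "S \<inter> {z. Re z = c}"
  have "connected (Im ` ?T)"
    by (intro connected_continuous_image continuous_intros assms(1))
  moreover have "a \<in> Im ` ?T" "b \<in> Im ` ?T"
    using assms(2,3) by force+
  ultimately have "y \<in> Im ` ?T"
    using assms(4,5) unfolding connected_iff_interval by blast
  then obtain z where "z \<in> S" "Re z = c" "y = Im z" by auto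
  then show ?thesis by (metis complex_surj)
qed

text \<open>On a vertical line \<open>Im (F w)\<close> has derivative
  \<open>1 - 2 * Re (deriv G w)\<close>, which is positive. As \<open>F\<close> keeps real parts,
  two points with the same image lie on one such line, so injectivity on each line suffices.\<close>

lemma vertical_shear:
  assumes dom: "domain_convex_imag S" and hol: "G holomorphic_on S"
    and der: "\<And>w. w \<in> S \<Longrightarrow> Re (deriv G w) < 1/2"
  defines "F \<equiv> \<lambda>w. w - 2 * \<i> * of_real (Im (G w))"
  shows "inj_on F S" and "domain_convex_imag (F ` S)"
proof -
  have S: "open S" "connected S" "S \<noteq> {}" "\<And>c. connected (S \<inter> {z. Re z = c})"
    using dom by (auto simp: domain_convex_imag_def)
  have Re_F [simp]: "Re (F w) = Re w" for w
    by (simp add: F_def)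
  have contF: "continuous_on S F"
    unfolding F_def by (intro continuous_intros holomorphic_on_imp_continuous_on hol)
  have less: "Im (F (Complex c a)) < Im (F (Complex c b))"
    if "Complex c a \<in> S" "Complex c b \<in> S" "a < b" for a b c
  proof (rule DERIV_pos_imp_increasing [OF \<open>a < b\<close>])
    fix y assume "a \<le> y" "y \<le> b"
    then have y: "Complex c y \<in> S"
      using vertical_section_segment [OF S(4) that(1,2)] by blast
    have G: "(G has_field_derivative deriv G (Complex c y)) (at (Complex c y))"
      using holomorphic_derivI [OF hol S(1) y] .
    have "((\<lambda>y. Complex c y) has_vector_derivative \<i>) (at y)"
      unfolding complex_eq_iff Complex_eq
      by (auto intro!: derivative_eq_intros)
    then have "((\<lambda>y. G (Complex c y)) has_vector_derivative \<i> * deriv G (Complex c y)) (at y)"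
      using field_vector_diff_chain_at [where f = "Complex c" and g = G] G by (simp add: o_def)
    \<comment> \<open>Moving upwards multiplies the complex derivative by \<i>, and
      \<open>Im (\<i> * d) = Re d\<close>. This is how a bound on the real part of
      \<open>deriv G\<close> controls an imaginary part.\<close>
    then have "((\<lambda>y. Im (G (Complex c y))) has_vector_derivative Re (deriv G (Complex c y))) (at y)"
      using bounded_linear.has_vector_derivative [OF bounded_linear_Im] by fastforce
    then have "((\<lambda>y. Im (F (Complex c y))) has_real_derivative 1 - 2 * Re (deriv G (Complex c y))) (at y)"
      unfolding has_real_derivative_iff_has_vector_derivative [symmetric]
      using DERIV_diff [OF DERIV_ident DERIV_cmult] by (simp add: F_def)
    with der [OF y]
    show "\<exists>d. ((\<lambda>y. Im (F (Complex c y))) has_real_derivative d) (at y) \<and> 0 < d"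
      by (intro exI conjI) auto
  qed
  show inj: "inj_on F S"
  proof (rule inj_onI)
    fix v w assume vw: "v \<in> S" "w \<in> S" "F v = F w"
    then have "Re v = Re w" by (metis Re_F)
    then have "\<not> Im v < Im w" "\<not> Im w < Im v"
      using less vw by (metis complex_surj less_irrefl)+
    with \<open>Re v = Re w\<close> show "v = w" by (simp add: complex_eq_iff)
  qed
  \<comment> \<open>Since real parts are kept, a section of the image is the image of a section and
    inherits its connectedness.\<close>
  have "F ` S \<inter> {z. Re z = c} = F ` (S \<inter> {z. Re z = c})" for c
    by auto
  moreover have "connected (F ` (S \<inter> {z. Re z = c}))" for c
    by (intro connected_continuous_image S continuous_on_subset [OF contF]) auto
  \<comment> \<open>In general \<open>F\<close> is not holomorphic, so openness of the image comes
    from invariance of domain for continuous injections.\<close>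
  ultimately show "domain_convex_imag (F ` S)"
    unfolding domain_convex_imag_def
    using invariance_of_domain [OF contF S(1) inj] connected_continuous_image [OF contF S(2)] S(3)
    by simp
qed

text \<open>Univalence makes \<open>w = \<phi> z\<close> a coordinate on the image of \<phi>. With
  \<psi> the inverse of \<phi>, the function \<open>G = g \<circ> \<psi>\<close> has derivative
  \<open>deriv g z / deriv \<phi> z\<close> at \<open>\<phi> z\<close>, and \<open>f\<close> is the
  vertical shear \<open>F\<close> after \<phi>.\<close>

lemma shear_construction:
  assumes "open S" and \<phi>: "\<phi> holomorphic_on S" "inj_on \<phi> S" "domain_convex_imag (\<phi> ` S)"
    and g: "g holomorphic_on S" and der: "\<And>z. z \<in> S \<Longrightarrow> Re (deriv g z / deriv \<phi> z) < 1/2"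
    and f: "\<And>z. z \<in> S \<Longrightarrow> f z = \<phi> z - 2 * \<i> * of_real (Im (g z))"
  shows "inj_on f S" and "domain_convex_imag (f ` S)"
proof -
  obtain \<psi> where \<psi>: "\<psi> holomorphic_on (\<phi> ` S)"
      "\<And>z. z \<in> S \<Longrightarrow> deriv \<phi> z * deriv \<psi> (\<phi> z) = 1" "\<And>z. z \<in> S \<Longrightarrow> \<psi> (\<phi> z) = z"
    using holomorphic_has_inverse [OF \<phi>(1) \<open>open S\<close> \<phi>(2)] by metis
  define G where "G = g \<circ> \<psi>"
  define F where "F = (\<lambda>w. w - 2 * \<i> * of_real (Im (G w)))"
  have openI: "open (\<phi> ` S)"
    using \<phi>(3) by (simp add: domain_convex_imag_def)
  have "\<psi> ` (\<phi> ` S) \<subseteq> S" using \<psi>(3) by auto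
  then have G: "G holomorphic_on \<phi> ` S"
    unfolding G_def by (intro holomorphic_on_compose_gen [OF \<psi>(1) g])
  have "Re (deriv G w) < 1/2" if "w \<in> \<phi> ` S" for w
  proof -
    from that obtain z where z: "z \<in> S" "w = \<phi> z" by auto
    have "deriv G w = deriv g (\<psi> w) * deriv \<psi> w"
      unfolding G_def
      using z that \<psi>(1,3) g openI \<open>open S\<close>
      by (intro deriv_chain) (auto intro: holomorphic_on_imp_differentiable_at)
    moreover have "deriv \<psi> w = 1 / deriv \<phi> z"
      using \<psi>(2) [OF z(1)] z by (metis div_by_0 mult_zero_left nonzero_mult_div_cancel_left zero_neq_one)
    ultimately show ?thesis
      using der [OF z(1)] \<psi>(3) z by simp
  qed
  note shear = vertical_shear [OF \<phi>(3) G this, folded F_def]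
  have f_eq: "f z = F (\<phi> z)" if "z \<in> S" for z
    using that by (simp add: f F_def G_def \<psi>(3))
  show "inj_on f S"
    using comp_inj_on [OF \<phi>(2) shear(1)] by (simp add: f_eq inj_on_def)
  have "f ` S = F ` (\<phi> ` S)"
    by (auto simp: f_eq image_image)
  with shear(2) show "domain_convex_imag (f ` S)" by simp
qed

text \<open>Translates sense-preservation, which is stated through Wirtinger derivatives of
  \<open>f\<close>, into a comparison of \<open>deriv g\<close> with \<open>deriv h\<close>.\<close>

lemma harmonic_rep_wirtinger:
  assumes rep: "harmonic_rep f h g" and z: "z \<in> unit_disc"
  shows "dz f z = deriv h z" and "dzbar f z = cnj (deriv g z)"
proof -
  have hol: "h holomorphic_on unit_disc" "g holomorphic_on unit_disc"
    and f: "\<And>z. z \<in> unit_disc \<Longrightarrow> f z = h z + cnj (g z)"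
    using rep by (auto simp: harmonic_rep_def)
  have h: "(h has_field_derivative deriv h z) (at z)"
    and g: "(g has_field_derivative deriv g z) (at z)"
    using holomorphic_derivI [OF hol(1) open_ball z] holomorphic_derivI [OF hol(2) open_ball z] .
  \<comment> \<open>One computation serves both partial derivatives: \<open>u = 1\<close> gives
    \<open>dx\<close> and \<open>u = \<i>\<close> gives \<open>dy\<close>. Conjugation is real
    linear, so it commutes with the derivative in \<open>t\<close>.\<close>
  have dir: "vector_derivative (\<lambda>t. f (z + u * of_real t)) (at (0::real))
      = u * deriv h z + cnj (u * deriv g z)" for u
  proof (rule vector_derivative_at)
    have line: "((\<lambda>t. z + u * of_real t) has_vector_derivative u) (at (0::real))"
      by (auto intro!: derivative_eq_intros)
    have "((\<lambda>t. h (z + u * of_real t)) has_vector_derivative u * deriv h z) (at (0::real))"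
      and "((\<lambda>t. g (z + u * of_real t)) has_vector_derivative u * deriv g z) (at (0::real))"
      using field_vector_diff_chain_at [OF line, of h] field_vector_diff_chain_at [OF line, of g] h g
      by (simp_all add: o_def)
    then have D: "((\<lambda>t. h (z + u * of_real t) + cnj (g (z + u * of_real t)))
        has_vector_derivative u * deriv h z + cnj (u * deriv g z)) (at (0::real))"
      by (intro has_vector_derivative_add has_vector_derivative_cnj)
    \<comment> \<open>The formula for \<open>f\<close> is known only on the disc. The parameters
      that stay in the disc form an open set containing 0, which is enough for the derivative
      there.\<close>
    have "open ((\<lambda>t::real. z + u * of_real t) -` unit_disc)"
      by (intro open_vimage open_ball continuous_intros)
    then show "((\<lambda>t. f (z + u * of_real t)) has_vector_derivative
        u * deriv h z + cnj (u * deriv g z)) (at (0::real))"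
      using D z f
      by (elim has_vector_derivative_transform_within_open) auto
  qed
  have "dx f z = deriv h z + cnj (deriv g z)" "dy f z = \<i> * deriv h z - \<i> * cnj (deriv g z)"
    using dir [of 1] dir [of \<i>] by (simp_all add: dx_def dy_def)
  then show "dz f z = deriv h z" "dzbar f z = cnj (deriv g z)"
    unfolding dz_def dzbar_def by (simp_all add: right_diff_distrib flip: mult.assoc)
qed

text \<open>Both sides say that \<open>a / b\<close> is closer to 0 than to 1, hence to the left of
  the perpendicular bisector of these two points.\<close>

lemma norm_less_norm_diff_iff:
  fixes a b :: complex
  assumes "b \<noteq> 0"
  shows "cmod a < cmod (b - a) \<longleftrightarrow> Re (a / b) < 1/2"
proof -
  have "cmod a < cmod (b - a) \<longleftrightarrow> cmod (a / b) < cmod (1 - a / b)"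
    using assms by (simp add: norm_divide divide_simps flip: diff_divide_eq_iff)
  also have "\<dots> \<longleftrightarrow> (cmod (a / b))\<^sup>2 < (cmod (1 - a / b))\<^sup>2"
    by (metis norm_ge_zero power2_less_imp_less power_strict_mono zero_less_numeral)
  \<comment> \<open>For \<open>q = a / b\<close> the squared moduli of \<open>1 - q\<close> and
    \<open>q\<close> differ by \<open>1 - 2 * Re q\<close>.\<close>
  also have "\<dots> \<longleftrightarrow> Re (a / b) < 1/2"
    unfolding cmod_power2 by (simp add: power2_eq_square algebra_simps)
  finally show ?thesis .
qed

text \<open>Substituting \<open>h = \<phi> - g\<close> leaves \<open>g\<close> as the only unknown:
  \<open>h + cnj g\<close> becomes a shear of \<phi>, and the comparison of \<open>deriv g\<close>
  with \<open>deriv \<phi> - deriv g\<close> becomes a half-plane condition. Dividing by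
  \<open>deriv \<phi>\<close> is legitimate because \<phi> is univalent.\<close>

lemma class_W_1_sense_preserving:
  assumes "f \<in> class_W 1 \<phi>" and sp: "sense_preserving_on f unit_disc"
    and \<phi>: "\<phi> holomorphic_on unit_disc" "inj_on \<phi> unit_disc"
  obtains g where "g holomorphic_on unit_disc"
    and "\<And>z. z \<in> unit_disc \<Longrightarrow> f z = \<phi> z - 2 * \<i> * of_real (Im (g z))"
    and "\<And>z. z \<in> unit_disc \<Longrightarrow> Re (deriv g z / deriv \<phi> z) < 1/2"
proof -
  obtain h g where rep: "harmonic_rep f h g" and sum: "\<And>z. z \<in> unit_disc \<Longrightarrow> h z + g z = \<phi> z"
    using assms(1) by (auto simp: class_W_def)
  have hol: "h holomorphic_on unit_disc" "g holomorphic_on unit_disc"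
    and f: "\<And>z. z \<in> unit_disc \<Longrightarrow> f z = h z + cnj (g z)"
    using rep by (auto simp: harmonic_rep_def)
  show ?thesis
  proof
    show "g holomorphic_on unit_disc" by fact
    fix z :: complex assume z: "z \<in> unit_disc"
    show "f z = \<phi> z - 2 * \<i> * of_real (Im (g z))"
      using f [OF z] sum [OF z, symmetric] by (simp add: complex_eq_iff)
    have "deriv \<phi> z = deriv (\<lambda>z. h z + g z) z"
      using eventually_nhds_in_open [OF open_ball z]
      by (intro deriv_cong_ev) (auto elim!: eventually_mono simp: sum)
    also have "\<dots> = deriv h z + deriv g z"
      using hol z by (intro deriv_add) (auto intro: holomorphic_on_imp_differentiable_at)
    finally have "deriv h z = deriv \<phi> z - deriv g z" by simp
    moreover have "cmod (deriv g z) < cmod (deriv h z)"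
      using sp z harmonic_rep_wirtinger [OF rep z]
      unfolding sense_preserving_on_def by (metis complex_mod_cnj)
    moreover have "deriv \<phi> z \<noteq> 0"
      using holomorphic_injective_imp_regular [OF \<phi>(1) open_ball \<phi>(2) z] .
    ultimately show "Re (deriv g z / deriv \<phi> z) < 1/2"
      using norm_less_norm_diff_iff by simp
  qed
qed

theorem theorem1:
  fixes \<phi> f1 f2 f3 :: "complex \<Rightarrow> complex" and t :: real
  assumes "\<phi> \<in> class_A"
    and "f1 \<in> class_SH0" and "f2 \<in> class_SH0"
    and "f1 \<in> class_W 1 \<phi>" and "f2 \<in> class_W 1 \<phi>"
    and "inj_on \<phi> unit_disc" and "convex_imag \<phi>"
    and "0 \<le> t" and "t \<le> 1"
    and "f3 = (\<lambda>z. of_real t * f1 z + of_real (1 - t) * f2 z)"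
  shows "inj_on f3 unit_disc \<and> convex_imag f3"
proof -
  have \<phi>: "\<phi> holomorphic_on unit_disc"
    using assms(1) by (simp add: class_A_def)
  have sp: "sense_preserving_on f1 unit_disc" "sense_preserving_on f2 unit_disc"
    using assms(2,3) by (auto simp: class_SH0_def)
  obtain g1 where g1: "g1 holomorphic_on unit_disc"
      "\<And>z. z \<in> unit_disc \<Longrightarrow> f1 z = \<phi> z - 2 * \<i> * of_real (Im (g1 z))"
      "\<And>z. z \<in> unit_disc \<Longrightarrow> Re (deriv g1 z / deriv \<phi> z) < 1/2"
    using class_W_1_sense_preserving [OF assms(4) sp(1) \<phi> assms(6)] by blast
  obtain g2 where g2: "g2 holomorphic_on unit_disc"
      "\<And>z. z \<in> unit_disc \<Longrightarrow> f2 z = \<phi> z - 2 * \<i> * of_real (Im (g2 z))"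
      "\<And>z. z \<in> unit_disc \<Longrightarrow> Re (deriv g2 z / deriv \<phi> z) < 1/2"
    using class_W_1_sense_preserving [OF assms(5) sp(2) \<phi> assms(6)] by blast
  \<comment> \<open>The weights are real, so they pass through \<open>Im\<close>, and they add up to
    1, so both copies of \<phi> combine to \<phi>. Hence \<open>f3\<close> is the shear of \<phi>
    given by this \<open>g\<close>.\<close>
  define g where "g = (\<lambda>z. of_real t * g1 z + of_real (1 - t) * g2 z)"
  have g: "g holomorphic_on unit_disc"
    unfolding g_def by (intro holomorphic_intros g1 g2)
  have f3: "f3 z = \<phi> z - 2 * \<i> * of_real (Im (g z))" if "z \<in> unit_disc" for z
    by (simp add: assms(10) g_def g1(2) [OF that] g2(2) [OF that] complex_eq_iff algebra_simps)
  have "Re (deriv g z / deriv \<phi> z) < 1/2" if z: "z \<in> unit_disc" for z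
  proof -
    have "(g has_field_derivative of_real t * deriv g1 z + of_real (1 - t) * deriv g2 z) (at z)"
      unfolding g_def
      by (intro DERIV_add DERIV_cmult holomorphic_derivI [OF g1(1) open_ball z]
          holomorphic_derivI [OF g2(1) open_ball z])
    then have "deriv g z / deriv \<phi> z
        = of_real t * (deriv g1 z / deriv \<phi> z) + of_real (1 - t) * (deriv g2 z / deriv \<phi> z)"
      by (simp add: DERIV_imp_deriv add_divide_distrib)
    then have "Re (deriv g z / deriv \<phi> z)
        = t * Re (deriv g1 z / deriv \<phi> z) + (1 - t) * Re (deriv g2 z / deriv \<phi> z)"
      by (simp only: plus_complex.sel Re_complex_of_real Im_complex_of_real times_complex.sel)
    also have "\<dots> < 1/2"
      \<comment> \<open>Both bounds are strict and the weights are nonnegative with sum 1, so the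
        inequality stays strict even at the endpoints of the range of \<open>t\<close>.\<close>
      using convex_bound_lt [OF g1(3) [OF z] g2(3) [OF z], of t "1 - t"] assms(8,9) by simp
    finally show ?thesis .
  qed
  then show ?thesis
    using shear_construction [OF open_ball \<phi> assms(6) _ g _ f3] assms(7)
    unfolding convex_imag_def by blast
qed

end
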